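(* Let $B\in \mathrm{Mat}_{n\times n}(\mathbb{Z})$ be an acyclic sign-skew-symmetric matrix and let $\widetilde{B}=\begin{pmatrix}B\\ I_n\end{pmatrix}\in \mathrm{Mat}_{2n\times n}(\mathbb{Z})$ be its extended matrix. Then $\widetilde{B}$ admits a maximal green sequence.
   Context: An integer matrix $B=(b_{ij})$ of size $n\times n$ is sign-skew-symmetric if for all $1\le i,j\le n$ either $b_{ij}=b_{ji}=0$ or $b_{ij}b_{ji}<0$. Its associated simple quiver $\Delta(B)$ has vertices $1,\dots,n$ and exactly one arrow from $i$ to $j$ for each pair $(i,j)$ with $b_{ij}<0$. $B$ is acyclic if $\Delta(B)$ has no directed cycles. Mutation in direction $k$ ($1\le k\le n$) of a matrix $\begin{pmatrix}B\\ C\end{pmatrix}$ with $B,C\in \mathrm{Mat}_{n\times n}(\mathbb{Z})$ is $\mu_k\begin{pmatrix}B\\ C\end{pmatrix}=\begin{pmatrix}B'\\ C'\end{pmatrix}$, where $b'_{ij}=-b_{ij}$ if $i=k$ or $j=k$ and $b'_{ij}=b_{ij}+\tfrac12(|b_{ik}|b_{kj}+b_{ik}|b_{kj}|)$ otherwise, and $c'_{ij}=-c_{ij}$ if $j=k$ and $c'_{ij}=c_{ij}+\tfrac12(|c_{ik}|b_{kj}+c_{ik}|b_{kj}|)$ otherwise. The lower part $C$ is called the $C$-matrix and its columns the $c$-vectors. In a matrix $\begin{pmatrix}B'\\ C'\end{pmatrix}$ obtained from $\widetilde{B}$ by a finite sequence of mutations, an index $i\in\{1,\dots,n\}$ is green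 (respectively red) if all entries of the $i$-th column of $C'$ are non-negative (respectively non-positive). A sequence $(k_1,\dots,k_s)$ with $1\le k_j\le n$ is a green sequence for $\widetilde{B}$ if for every $1\le j\le s$ the index $k_j$ is green in $\mu_{k_{j-1}}\cdots\mu_{k_1}(\widetilde{B})$. It is a maximal green sequence if moreover $\mu_{k_s}\cdots\mu_{k_1}(\widetilde{B})$ has no green indices. *)

theory Defs
  imports "HOL-Analysis.Finite_Cartesian_Product"
begin

definition sign_skew_symmetric :: "int^'n::finite^'n \<Rightarrow> bool" where
  "sign_skew_symmetric B \<longleftrightarrow>
     (\<forall>i j. (B $ i $ j = 0 \<and> B $ j $ i = 0) \<or> B $ i $ j * B $ j $ i < 0)"

text \<open>The quiver has the index type as its vertex set; being simple, it is given by its set of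
  arrows, each arrow written as (source, target).\<close>

definition quiver :: "int^'n::finite^'n \<Rightarrow> ('n \<times> 'n) set" where
  "quiver B = {(i, j). B $ i $ j < 0}"

definition acyclic_matrix :: "int^'n::finite^'n \<Rightarrow> bool" where
  "acyclic_matrix B \<longleftrightarrow> acyclic (quiver B)"

text \<open>A pair \<open>(B, C)\<close> stands for the \<open>2n \<times> n\<close> matrix with upper part \<open>B\<close> and lower part \<open>C\<close>,
  where \<open>n\<close> is the cardinality of the index type.\<close>

type_synonym 'n ext_matrix = "(int^'n^'n) \<times> (int^'n^'n)"

definition extended :: "int^'n::finite^'n \<Rightarrow> 'n ext_matrix" where
  "extended B = (B, mat 1)"

text \<open>The factor one half in the mutation rule is rendered by integer division, which is exact here.\<close>

lemma mutation_term_even: "even (\<bar>x\<bar> * y + x * \<bar>y\<bar>)" for x y :: int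
  by (auto simp: abs_if)

definition mutate :: "'n::finite \<Rightarrow> 'n ext_matrix \<Rightarrow> 'n ext_matrix" where
  "mutate k M = (case M of (B, C) \<Rightarrow>
     (\<chi> i j. if i = k \<or> j = k then - B $ i $ j
             else B $ i $ j + (\<bar>B $ i $ k\<bar> * B $ k $ j + B $ i $ k * \<bar>B $ k $ j\<bar>) div 2,
      \<chi> i j. if j = k then - C $ i $ j
             else C $ i $ j + (\<bar>C $ i $ k\<bar> * B $ k $ j + C $ i $ k * \<bar>B $ k $ j\<bar>) div 2))"

text \<open>The head of the list is the first direction of mutation.\<close>

definition mutate_seq :: "'n::finite list \<Rightarrow> 'n ext_matrix \<Rightarrow> 'n ext_matrix" where
  "mutate_seq ks M = fold mutate ks M"

definition green :: "'n::finite ext_matrix \<Rightarrow> 'n \<Rightarrow> bool" where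
  "green M i \<longleftrightarrow> (\<forall>l. snd M $ l $ i \<ge> 0)"

definition green_sequence :: "'n::finite ext_matrix \<Rightarrow> 'n list \<Rightarrow> bool" where
  "green_sequence M ks \<longleftrightarrow>
     (\<forall>j < length ks. green (mutate_seq (take j ks) M) (ks ! j))"

definition maximal_green_sequence :: "'n::finite ext_matrix \<Rightarrow> 'n list \<Rightarrow> bool" where
  "maximal_green_sequence M ks \<longleftrightarrow>
     green_sequence M ks \<and> (\<nexists>i. green (mutate_seq ks M) i)"

end

(* Mutate along a linear extension of the acyclic quiver, always at a source of the current quiver.
   Mutation at a green source k only reverses the arrows at k and negates the column k of the
   C-matrix, so after the vertices of a predecessor-closed set S have been mutated, the arrows
   between S and its complement are reversed and the C-matrix is diagonal with entry -1 on S and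
   1 elsewhere. *)

theory Submission
  imports Defs
begin

text \<open>Mutating once at each vertex of \<open>S\<close> negates an off-diagonal entry once per
  index in \<open>S\<close>, so entries with both indices in \<open>S\<close> regain their
  sign.\<close>

definition reversed_at :: "int^'n::finite^'n \<Rightarrow> 'n set \<Rightarrow> 'n ext_matrix" where
  "reversed_at B S =
     (\<chi> i j. if i \<in> S \<longleftrightarrow> j \<in> S then B $ i $ j else - B $ i $ j,
      \<chi> i j. if i = j then (if i \<in> S then -1 else 1) else 0)"

lemma extended_eq_reversed_at_empty: "extended B = reversed_at B {}"
  by (simp add: extended_def reversed_at_def mat_def vec_eq_iff)

lemma green_reversed_at_iff: "green (reversed_at B S) k \<longleftrightarrow> k \<notin> S"
  by (auto simp: green_def reversed_at_def)

lemma green_sequence_Nil: "green_sequence M []"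
  by (simp add: green_sequence_def)

lemma green_sequence_Cons:
  "green_sequence M (k # ks) \<longleftrightarrow> green M k \<and> green_sequence (mutate k M) ks"
  by (simp add: green_sequence_def mutate_seq_def All_less_Suc2)

lemma sign_skew_symmetric_nonneg_iff:
  assumes "sign_skew_symmetric B"
  shows "B $ i $ j \<ge> 0 \<longleftrightarrow> B $ j $ i \<le> 0"
  using assms[unfolded sign_skew_symmetric_def, rule_format, of i j]
  by (auto simp: mult_less_0_iff)

lemma mutation_term_eq_0:
  fixes x y :: int
  assumes "x \<ge> 0" "y \<le> 0"
  shows "(\<bar>x\<bar> * y + x * \<bar>y\<bar>) div 2 = 0"
  using assms by simp

text \<open>Each correction term pairs a non-negative entry of column \<open>k\<close> (for
  \<open>C\<close> by greenness) with a non-positive entry of row \<open>k\<close> of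
  \<open>B\<close>, so its two summands cancel.\<close>

lemma mutate_source:
  fixes B C :: "int^'n::finite^'n"
  assumes "\<And>j. B $ k $ j \<le> 0" and "\<And>i. B $ i $ k \<ge> 0" and "green (B, C) k"
  shows "mutate k (B, C) =
    (\<chi> i j. if i = k \<or> j = k then - B $ i $ j else B $ i $ j,
     \<chi> i j. if j = k then - C $ i $ j else C $ i $ j)"
  using assms by (simp add: mutate_def green_def mutation_term_eq_0 vec_eq_iff)

text \<open>Reversing the arrows between \<open>S\<close> and its complement turns the sign
  conditions on column \<open>k\<close> of \<open>B\<close> into those of a source, so
  \<open>mutate_source\<close> applies.\<close>

lemma mutate_reversed_at:
  assumes sss: "sign_skew_symmetric B" and "k \<notin> S"
    and in_S: "\<And>i. i \<in> S \<Longrightarrow> B $ i $ k \<le> 0"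
    and out_S: "\<And>i. i \<notin> S \<Longrightarrow> B $ i $ k \<ge> 0"
  shows "mutate k (reversed_at B S) = reversed_at B (insert k S)"
proof -
  have in_S': "B $ k $ i \<ge> 0" if "i \<in> S" for i
    using in_S[OF that] sign_skew_symmetric_nonneg_iff[OF sss] by blast
  have out_S': "B $ k $ i \<le> 0" if "i \<notin> S" for i
    using out_S[OF that] sign_skew_symmetric_nonneg_iff[OF sss] by blast
  \<comment> \<open>Mutation negates the entry at \<open>(k, k)\<close>, whereas
    \<open>reversed_at\<close> keeps it.\<close>
  have "B $ k $ k = 0"
    using out_S out_S' \<open>k \<notin> S\<close> by (meson order_antisym)
  moreover have "green (reversed_at B S) k"
    using \<open>k \<notin> S\<close> by (simp add: green_reversed_at_iff)
  ultimately show ?thesis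
    unfolding reversed_at_def using \<open>k \<notin> S\<close> in_S out_S in_S' out_S'
    by (subst mutate_source) (auto simp: vec_eq_iff)
qed

text \<open>The sign hypothesis makes \<open>S\<close>, the vertices mutated so far, closed under
  predecessors. This invariant survives adding a vertex minimal outside \<open>S\<close>, which
  exists by acyclicity.\<close>

lemma ex_green_sequence_reversed_at:
  fixes B :: "int^'n::finite^'n"
  assumes sss: "sign_skew_symmetric B" and acyc: "acyclic_matrix B"
    and "\<And>i j. i \<notin> S \<Longrightarrow> j \<in> S \<Longrightarrow> B $ i $ j \<ge> 0"
  shows "\<exists>ks. green_sequence (reversed_at B S) ks \<and>
           mutate_seq ks (reversed_at B S) = reversed_at B UNIV"
  using assms(3)
proof (induction "card (- S)" arbitrary: S rule: less_induct)
  case less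
  show ?case
  proof (cases "S = UNIV")
    case True
    then show ?thesis
      by (intro exI[of _ "[]"]) (simp add: green_sequence_Nil mutate_seq_def)
  next
    case False
    then have "\<exists>k. k \<in> - S"
      by blast
    moreover have "wf (quiver B)"
      using acyc by (simp add: acyclic_matrix_def finite_acyclic_wf)
    ultimately obtain k where k: "k \<notin> S" "\<And>i. (i, k) \<in> quiver B \<Longrightarrow> i \<in> S"
      unfolding wf_eq_minimal by (metis Compl_iff)
    have out_S: "B $ i $ k \<ge> 0" if "i \<notin> S" for i
      using k(2)[of i] that by (force simp: quiver_def)
    have "B $ i $ k \<le> 0" if "i \<in> S" for i
      using less.prems[OF k(1) that] sign_skew_symmetric_nonneg_iff[OF sss] by blast
    then have step: "mutate k (reversed_at B S) = reversed_at B (insert k S)"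
      using sss k(1) out_S by (intro mutate_reversed_at)
    have "card (- insert k S) < card (- S)"
      using k(1) by (intro psubset_card_mono) auto
    \<comment> \<open>For \<open>j = k\<close> this is the minimality of \<open>k\<close>; otherwise
      it is the invariant for \<open>S\<close>.\<close>
    moreover have "B $ i $ j \<ge> 0" if "i \<notin> insert k S" "j \<in> insert k S" for i j
      using that less.prems out_S by auto
    ultimately obtain ks where
      "green_sequence (reversed_at B (insert k S)) ks"
      "mutate_seq ks (reversed_at B (insert k S)) = reversed_at B UNIV"
      using less.hyps by blast
    then show ?thesis
      using k(1) step
      by (intro exI[of _ "k # ks"])
        (simp add: green_sequence_Cons green_reversed_at_iff mutate_seq_def)
  qed
qed

theorem theorem3p10:
  fixes B :: "int^'n^'n"
  assumes "sign_skew_symmetric B"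
    and "acyclic_matrix B"
  shows "\<exists>ks. maximal_green_sequence (extended B) ks"
  \<comment> \<open>The invariant is vacuous for the empty set, and no index is green once
    \<open>S\<close> is \<open>UNIV\<close>.\<close>
  using ex_green_sequence_reversed_at[OF assms, of "{}"]
  by (auto simp: maximal_green_sequence_def extended_eq_reversed_at_empty green_reversed_at_iff)

end
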